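(* For every integer $n \ge 1$ we have $$V_{n,n+1}(x) = D_n(x) = \frac{\sin \pi(2n+1)x}{\sin \pi x},$$ where $D_n$ is the Dirichlet kernel for functions of period $1$. In particular, $$\|V_{n,n+1}\|_{L^1(\mathbb{T})} = \|D_n\|_{L^1(\mathbb{T})} = L_n,$$ where $L_n$ is the $n$-th Lebesgue constant.
   Context: Here $\mathbb{T} = \mathbb{R}/\mathbb{Z}$ and $\|f\|_{L^1(\mathbb{T})} = \int_0^1 |f(x)|\,dx$ for a function $f$ of period $1$. For integers $0 \le r < s$, the de la Vallée Poussin kernel (of period $1$) is $$V_{r,s}(x) = \frac{(\sin s\pi x)^2 - (\sin r\pi x)^2}{(s-r)(\sin \pi x)^2}.$$ The Dirichlet kernel is $D_n(x) = \sum_{k=-n}^{n} e^{2\pi i k x}$. All quotients of trigonometric functions are extended by continuity to integer $x$. The $n$-th Lebesgue constant is $$L_n = \frac{1}{2\pi}\int_0^{2\pi} \left|\frac{\sin\left((n+\tfrac12)\theta\right)}{\sin(\theta/2)}\right| d\theta.$$ *)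

theory Defs
  imports "HOL-Analysis.Analysis"
begin

text \<open>The quotient of two functions, extended by continuity to the zeros of the denominator.
  At such a zero the value is the limit of the quotient (and is unspecified if that
  limit does not exist), not the value 0 given by the convention for division by 0.\<close>

definition ext_quot :: "(real \<Rightarrow> real) \<Rightarrow> (real \<Rightarrow> real) \<Rightarrow> real \<Rightarrow> real" where
  "ext_quot f g x =
     (if g x = 0 then Lim (at x) (\<lambda>y. f y / g y) else f x / g x)"

text \<open>The kernel is meant for \<open>r < s\<close>; the zeros of its denominator are then exactly the integers.\<close>

definition vallee_poussin_kernel :: "nat \<Rightarrow> nat \<Rightarrow> real \<Rightarrow> real" where
  "vallee_poussin_kernel r s =
     ext_quot (\<lambda>x. (sin (real s * pi * x))\<^sup>2 - (sin (real r * pi * x))\<^sup>2)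
              (\<lambda>x. (real s - real r) * (sin (pi * x))\<^sup>2)"

definition dirichlet_kernel :: "nat \<Rightarrow> real \<Rightarrow> complex" where
  "dirichlet_kernel n x =
     (\<Sum>k\<in>{- int n..int n}. exp (2 * complex_of_real pi * \<i> * of_int k * complex_of_real x))"

text \<open>Functions on \<open>\<real>/\<int>\<close> are represented by functions of period 1 on the real line.\<close>

definition L1_norm_circle :: "(real \<Rightarrow> 'a::real_normed_vector) \<Rightarrow> real" where
  "L1_norm_circle f = (LINT x:{0..1}|lborel. norm (f x))"

definition lebesgue_constant :: "nat \<Rightarrow> real" where
  "lebesgue_constant n =
     1 / (2 * pi) *
     (LINT \<theta>:{0..2 * pi}|lborel.
        \<bar>ext_quot (\<lambda>\<theta>. sin ((real n + 1 / 2) * \<theta>)) (\<lambda>\<theta>. sin (\<theta> / 2)) \<theta>\<bar>)"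

end

theory Submission
  imports Defs
begin

text \<open>
  Pairing the frequencies \<open>k\<close> and \<open>-k\<close> shows that the Dirichlet kernel is the real trigonometric
  polynomial \<open>1 + 2 \<Sum>\<^sub>k cos (2\<pi>kx)\<close>. Multiplied by \<open>sin (\<pi>x)\<close> this sum telescopes to
  \<open>sin ((2n+1)\<pi>x)\<close>, and since
  \<open>sin\<^sup>2 ((n+1)t) - sin\<^sup>2 (nt) = sin ((2n+1)t) sin t\<close>, the numerator of \<open>V\<^bsub>n,n+1\<^esub>\<close> is the same
  polynomial multiplied by \<open>sin\<^sup>2 (\<pi>x)\<close>. Hence all the quotients involved have numerator
  \<open>h \<cdot> g\<close>, where \<open>g\<close> is the denominator and \<open>h\<close> is a continuous function. The zeros of \<open>g\<close> are
  isolated, so the continuous extension of such a quotient is \<open>h\<close> itself, at the integers too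
  (lemma \<open>ext_quot_eqI\<close>).

  The first equality of norms is then immediate, and the second is the substitution
  \<open>\<theta> = 2\<pi>x\<close>, for which \<open>(n + 1/2)\<theta> = (2n+1)\<pi>x\<close> and \<open>\<theta>/2 = \<pi>x\<close>.
\<close>

lemma ext_quot_eqI:
  assumes factor: "\<And>y. f y = h y * g y"
    and cont: "isCont h x"
    and isolated: "g x = 0 \<Longrightarrow> eventually (\<lambda>y. g y \<noteq> 0) (at x)"
  shows "ext_quot f g x = h x"
proof (cases "g x = 0")
  case True
  have "eventually (\<lambda>y. h y = f y / g y) (at x)"
    using isolated[OF True] by eventually_elim (simp add: factor)
  then have "((\<lambda>y. f y / g y) \<longlongrightarrow> h x) (at x)"
    using cont[unfolded isCont_def] by (rule Lim_transform_eventually[rotated])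
  then have "Lim (at x) (\<lambda>y. f y / g y) = h x"
    by (intro tendsto_Lim) simp_all
  with True show ?thesis
    by (simp add: ext_quot_def)
qed (simp add: ext_quot_def factor)

text \<open>At a zero \<open>x\<close> the addition formula gives
  \<open>sin (cy) = sin (c(y - x)) cos (cx)\<close>, and zero is the only zero of the sine in \<open>(-\<pi>, \<pi>)\<close>.\<close>

lemma isolated_zeros_sin_mult:
  fixes c x :: real
  assumes "c \<noteq> 0" and "sin (c * x) = 0"
  shows "eventually (\<lambda>y. sin (c * y) \<noteq> 0) (at x)"
  unfolding eventually_at
proof (intro exI[of _ "pi / \<bar>c\<bar>"] conjI ballI impI)
  show "0 < pi / \<bar>c\<bar>"
    using \<open>c \<noteq> 0\<close> by simp
  fix y assume y: "y \<noteq> x \<and> dist y x < pi / \<bar>c\<bar>"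
  then have "\<bar>c * (y - x)\<bar> < pi"
    using \<open>c \<noteq> 0\<close> unfolding abs_mult
    by (simp add: dist_real_def pos_less_divide_eq mult.commute)
  moreover have "c * (y - x) \<noteq> 0"
    using y \<open>c \<noteq> 0\<close> by simp
  ultimately have "sin (c * (y - x)) \<noteq> 0"
    using sin_eq_0_pi[of "c * (y - x)"] by (metis abs_less_iff minus_less_iff)
  moreover have "cos (c * x) \<noteq> 0"
    using assms(2) sin_cos_squared_add[of "c * x"] by auto
  moreover have "sin (c * y) = sin (c * (y - x)) * cos (c * x)"
    using sin_add[of "c * (y - x)" "c * x"] assms(2) by (simp add: algebra_simps)
  ultimately show "sin (c * y) \<noteq> 0"
    by simp
qed

definition dirichlet_cosine_sum :: "nat \<Rightarrow> real \<Rightarrow> real" where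
  "dirichlet_cosine_sum n x = 1 + 2 * (\<Sum>k=1..n. cos (2 * pi * real k * x))"

lemma dirichlet_kernel_eq_cosine_sum:
  "dirichlet_kernel n x = complex_of_real (dirichlet_cosine_sum n x)"
proof (induction n)
  case 0
  show ?case
    by (simp add: dirichlet_kernel_def dirichlet_cosine_sum_def)
next
  case (Suc n)
  define e where "e k = exp (2 * complex_of_real pi * \<i> * of_int k * complex_of_real x)" for k :: int
  let ?t = "2 * pi * real (Suc n) * x"
  have e_cis: "e k = cis (2 * pi * of_int k * x)" for k
    by (simp add: e_def cis_conv_exp mult_ac)
  have "{- int (Suc n)..int (Suc n)}
      = insert (- int (Suc n)) (insert (int (Suc n)) {- int n..int n})"
    by auto
  then have "dirichlet_kernel (Suc n) x
      = e (- int (Suc n)) + (e (int (Suc n)) + dirichlet_kernel n x)"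
    unfolding dirichlet_kernel_def e_def[symmetric] by simp
  also have "\<dots> = cis (- ?t) + (cis ?t + dirichlet_kernel n x)"
    by (simp add: e_cis algebra_simps)
  also have "\<dots> = complex_of_real (2 * cos ?t) + dirichlet_kernel n x"
    by (simp add: complex_eq_iff)
  also have "\<dots> = complex_of_real (dirichlet_cosine_sum (Suc n) x)"
    by (simp add: Suc.IH dirichlet_cosine_sum_def algebra_simps)
  finally show ?case .
qed

text \<open>The sum telescopes because \<open>2 cos (2mt) sin t = sin ((2m+1)t) - sin ((2m-1)t)\<close>.\<close>

lemma dirichlet_cosine_sum_mult_sin:
  "dirichlet_cosine_sum n x * sin (pi * x) = sin (pi * (2 * real n + 1) * x)"
proof (induction n)
  case 0
  show ?case
    by (simp add: dirichlet_cosine_sum_def)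
next
  case (Suc n)
  let ?a = "2 * pi * real (Suc n) * x" and ?t = "pi * x"
  have "dirichlet_cosine_sum (Suc n) x * sin ?t
      = dirichlet_cosine_sum n x * sin ?t + 2 * cos ?a * sin ?t"
    by (simp add: dirichlet_cosine_sum_def algebra_simps)
  also have "\<dots> = sin (?a - ?t) + 2 * cos ?a * sin ?t"
    unfolding Suc.IH by (simp add: algebra_simps)
  also have "\<dots> = sin (?a + ?t)"
    by (simp add: sin_add sin_diff)
  also have "?a + ?t = pi * (2 * real (Suc n) + 1) * x"
    by (simp add: algebra_simps)
  finally show ?case .
qed

lemma isCont_dirichlet_cosine_sum: "isCont (dirichlet_cosine_sum n) x"
  unfolding dirichlet_cosine_sum_def by (intro continuous_intros)

lemma sin_squared_diff:
  fixes a b :: real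
  shows "(sin a)\<^sup>2 - (sin b)\<^sup>2 = sin (a + b) * sin (a - b)"
proof -
  have "sin (a + b) * sin (a - b) = (sin a)\<^sup>2 * (cos b)\<^sup>2 - (cos a)\<^sup>2 * (sin b)\<^sup>2"
    by (simp add: sin_add sin_diff power2_eq_square algebra_simps)
  also have "\<dots> = (sin a)\<^sup>2 - (sin b)\<^sup>2"
    by (simp add: cos_squared_eq algebra_simps)
  finally show ?thesis
    by simp
qed

lemma vallee_poussin_kernel_Suc:
  "vallee_poussin_kernel n (n + 1) x = dirichlet_cosine_sum n x"
  unfolding vallee_poussin_kernel_def
proof (rule ext_quot_eqI[OF _ isCont_dirichlet_cosine_sum])
  fix y :: real
  have "(sin (real (n + 1) * pi * y))\<^sup>2 - (sin (real n * pi * y))\<^sup>2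
      = sin (pi * (2 * real n + 1) * y) * sin (pi * y)"
    unfolding sin_squared_diff by (simp add: algebra_simps)
  then show "(sin (real (n + 1) * pi * y))\<^sup>2 - (sin (real n * pi * y))\<^sup>2
      = dirichlet_cosine_sum n y * ((real (n + 1) - real n) * (sin (pi * y))\<^sup>2)"
    by (simp add: dirichlet_cosine_sum_mult_sin[symmetric] power2_eq_square)
qed (use isolated_zeros_sin_mult[of pi x] in simp)

lemma sin_quotient_eq_dirichlet_cosine_sum:
  "ext_quot (\<lambda>y. sin (pi * (2 * real n + 1) * y)) (\<lambda>y. sin (pi * y)) x
    = dirichlet_cosine_sum n x"
  by (rule ext_quot_eqI[OF _ isCont_dirichlet_cosine_sum])
    (simp_all add: dirichlet_cosine_sum_mult_sin isolated_zeros_sin_mult)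

lemma sin_half_angle_quotient_eq_dirichlet_cosine_sum:
  "ext_quot (\<lambda>\<theta>. sin ((real n + 1 / 2) * \<theta>)) (\<lambda>\<theta>. sin (\<theta> / 2)) \<theta>
    = dirichlet_cosine_sum n (\<theta> / (2 * pi))"
proof (rule ext_quot_eqI)
  fix t :: real
  have "pi * (2 * real n + 1) * (t / (2 * pi)) = (real n + 1 / 2) * t"
    by (simp add: field_simps)
  moreover have "pi * (t / (2 * pi)) = t / 2"
    by simp
  ultimately show "sin ((real n + 1 / 2) * t) = dirichlet_cosine_sum n (t / (2 * pi)) * sin (t / 2)"
    using dirichlet_cosine_sum_mult_sin[of n "t / (2 * pi)"] by metis
next
  show "isCont (\<lambda>\<theta>. dirichlet_cosine_sum n (\<theta> / (2 * pi))) \<theta>"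
    by (rule isCont_o2[OF _ isCont_dirichlet_cosine_sum]) (intro continuous_intros; simp)
qed (use isolated_zeros_sin_mult[of "1 / 2" \<theta>] in simp)

lemma lebesgue_constant_eq_L1_norm:
  "lebesgue_constant n = L1_norm_circle (dirichlet_cosine_sum n)"
proof -
  let ?D = "dirichlet_cosine_sum n"
  have "2 * pi * x \<in> {0..2 * pi} \<longleftrightarrow> x \<in> {0..1}" for x
    using mult_le_cancel_left_pos[of "2 * pi" x 1] mult_le_cancel_left_pos[of "2 * pi" 0 x] by simp
  then have scaled: "indicator {0..2 * pi} (2 * pi * x) = (indicator {0..1} x :: real)" for x
    unfolding indicator_def by presburger
  have "(LINT \<theta>:{0..2 * pi}|lborel. \<bar>?D (\<theta> / (2 * pi))\<bar>)
      = 2 * pi * (LINT x|lborel. indicator {0..2 * pi} (2 * pi * x) *\<^sub>R \<bar>?D x\<bar>)"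
    unfolding set_lebesgue_integral_def
    by (subst lborel_integral_real_affine[where c = "2 * pi" and t = 0]) simp_all
  also have "\<dots> = 2 * pi * L1_norm_circle ?D"
    by (simp add: L1_norm_circle_def set_lebesgue_integral_def scaled)
  finally show ?thesis
    by (simp add: lebesgue_constant_def sin_half_angle_quotient_eq_dirichlet_cosine_sum)
qed

theorem theorem1p2:
  fixes n :: nat
  assumes "n \<ge> 1"
  shows "(\<forall>x::real.
            complex_of_real (vallee_poussin_kernel n (n + 1) x) = dirichlet_kernel n x \<and>
            dirichlet_kernel n x =
              complex_of_real
                (ext_quot (\<lambda>y. sin (pi * (2 * real n + 1) * y)) (\<lambda>y. sin (pi * y)) x)) \<and>
         L1_norm_circle (vallee_poussin_kernel n (n + 1)) = L1_norm_circle (dirichlet_kernel n) \<and>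
         L1_norm_circle (dirichlet_kernel n) = lebesgue_constant n"
proof -
  have "L1_norm_circle (dirichlet_kernel n) = L1_norm_circle (dirichlet_cosine_sum n)"
    by (simp add: L1_norm_circle_def dirichlet_kernel_eq_cosine_sum)
  moreover have "vallee_poussin_kernel n (n + 1) = dirichlet_cosine_sum n"
    using vallee_poussin_kernel_Suc by blast
  ultimately show ?thesis
    using sin_quotient_eq_dirichlet_cosine_sum
    by (simp add: dirichlet_kernel_eq_cosine_sum lebesgue_constant_eq_L1_norm)
qed

end
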